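(* Over the alphabet $\{a,b,c\}$, $$\varTheta(a,b,c)=c\cdot \mathbf T(a,b,c),$$ that is, the infinite word $\varTheta$ is obtained by prefixing the Tribonacci word $\mathbf T$ with the letter $c$.
   Context: $\varTheta(a,b,c)$ is the infinite word that is the fixed point of the morphism $\theta: a\to cabaaba,\ b\to cababa,\ c\to caba$; it begins with $c$ and equals $\lim_{k\to\infty}\theta^k(c)$. The Tribonacci word $\mathbf T(a,b,c)$ is the infinite word that is the fixed point of the morphism $\tau: a\to ab,\ b\to ac,\ c\to a$; it begins with $a$ and equals $\lim_{k\to\infty}\tau^k(a)$. The dot denotes concatenation. *)

theory Defs
  imports Main "HOL-Library.Stream"
begin

text \<open>Finite words are lists and infinite words are streams.  A morphism is given by the images of
  the letters; it extends to finite words by concatenation.  \<^const>\<open>flat\<close> has the intended meaning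
  only on streams of nonempty lists, so the extension to infinite words is meant for non-erasing
  morphisms, which both morphisms below are.\<close>

definition morph :: "('a \<Rightarrow> 'a list) \<Rightarrow> 'a list \<Rightarrow> 'a list" where
  "morph f u = concat (map f u)"

definition morph_inf :: "('a \<Rightarrow> 'a list) \<Rightarrow> 'a stream \<Rightarrow> 'a stream" where
  "morph_inf f w = flat (smap f w)"

definition fixed_word :: "('a \<Rightarrow> 'a list) \<Rightarrow> 'a \<Rightarrow> 'a stream" where
  "fixed_word f x = (THE w. shd w = x \<and> morph_inf f w = w)"

text \<open>A sequence of finite words converges to an infinite word if every prefix of the latter is a
  prefix of almost all members of the sequence.  (\<^term>\<open>stake n w\<close> has length \<^term>\<open>n\<close>, so this forces
  the lengths to tend to infinity.)\<close>

definition words_tendsto :: "(nat \<Rightarrow> 'a list) \<Rightarrow> 'a stream \<Rightarrow> bool" where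
  "words_tendsto u w \<longleftrightarrow> (\<forall>n. \<forall>\<^sub>F k in sequentially. take n (u k) = stake n w)"

datatype letter = A | B | C

fun theta :: "letter \<Rightarrow> letter list" where
  "theta A = [C, A, B, A, A, B, A]"
| "theta B = [C, A, B, A, B, A]"
| "theta C = [C, A, B, A]"

fun tau :: "letter \<Rightarrow> letter list" where
  "tau A = [A, B]"
| "tau B = [A, C]"
| "tau C = [A]"

definition Theta :: "letter stream" where
  "Theta = fixed_word theta C"

definition Tribonacci :: "letter stream" where
  "Tribonacci = fixed_word tau A"

text \<open>The remaining facts show that the two words are well defined and are the limits of the
  iterates of their morphisms.\<close>

lemma stream_eqI: "(\<And>n. stake n s = stake n t) \<Longrightarrow> s = t"
proof -
  assume *: "\<And>n. stake n s = stake n t"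
  have "s !! n = t !! n" for n
    using *[of "Suc n"] by (metis lessI stake_nth)
  then show ?thesis
    by (metis smap_alt stream.map_id)
qed

lemma morph_append: "morph f (u @ v) = morph f u @ morph f v"
  by (simp add: morph_def)

lemma length_morph_ge:
  assumes "\<And>y. f y \<noteq> []"
  shows "length u \<le> length (morph f u)"
proof (induction u)
  case (Cons y u)
  moreover have "length (f y) \<ge> 1" using assms[of y] by (cases "f y") auto
  ultimately show ?case by (simp add: morph_def)
qed (simp add: morph_def)

lemma morph_inf_shift:
  assumes "\<And>y. f y \<noteq> []"
  shows "morph_inf f (u @- w) = morph f u @- morph_inf f w"
  using assms by (induction u) (auto simp: morph_inf_def morph_def flat_Stream)

context
  fixes f :: "'a \<Rightarrow> 'a list" and x :: 'a and v :: "'a list"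
  assumes nonempty: "\<And>y. f y \<noteq> []" and prolongable: "f x = x # v" "v \<noteq> []"
begin

lemma iterate_Suc: "\<exists>r. (morph f ^^ Suc k) [x] = (morph f ^^ k) [x] @ r \<and> r \<noteq> []"
proof (induction k)
  case 0
  then show ?case using prolongable by (simp add: morph_def)
next
  case (Suc k)
  then obtain r where r: "(morph f ^^ Suc k) [x] = (morph f ^^ k) [x] @ r" "r \<noteq> []" by blast
  have "morph f r \<noteq> []"
    using length_morph_ge[of f r] nonempty r(2) by auto
  moreover have "(morph f ^^ Suc (Suc k)) [x] = (morph f ^^ Suc k) [x] @ morph f r"
    by (metis r(1) funpow.simps(2) comp_apply morph_append)
  ultimately show ?case by blast
qed

lemma length_iterate: "k < length ((morph f ^^ k) [x])"
proof (induction k)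
  case (Suc k)
  obtain r where "(morph f ^^ Suc k) [x] = (morph f ^^ k) [x] @ r" "r \<noteq> []"
    using iterate_Suc by blast
  with Suc show ?case by (cases r) auto
qed simp

lemma iterate_mono: "k \<le> l \<Longrightarrow> \<exists>r. (morph f ^^ l) [x] = (morph f ^^ k) [x] @ r"
proof (induction rule: dec_induct)
  case (step l)
  then show ?case using iterate_Suc[of l] by (metis append.assoc)
qed simp

lemma fixed_prefix:
  assumes "shd w = x" "morph_inf f w = w"
  shows "\<exists>r. w = (morph f ^^ k) [x] @- r"
proof (induction k)
  case 0
  then show ?case using assms(1) by (cases w) auto
next
  case (Suc k)
  then obtain r where "w = (morph f ^^ k) [x] @- r" by blast
  then have "w = morph f ((morph f ^^ k) [x]) @- morph_inf f r"
    using assms(2) morph_inf_shift[of f] nonempty by metis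
  then show ?case by auto
qed

lemma prefixes_imp_stake:
  assumes "\<And>k. \<exists>r. w = (morph f ^^ k) [x] @- r" "n \<le> k"
  shows "take n ((morph f ^^ k) [x]) = stake n w"
proof -
  obtain r where "w = (morph f ^^ k) [x] @- r" using assms(1) by blast
  with length_iterate[of k] assms(2) show ?thesis
    by (simp add: stake_shift)
qed

lemma prefixes_exist: "\<exists>w. \<forall>k. \<exists>r. w = (morph f ^^ k) [x] @- r"
proof -
  let ?P = "\<lambda>k. (morph f ^^ k) [x]"
  define w where "w = smap (\<lambda>n. ?P n ! n) nats"
  have nth: "w !! n = ?P k ! n" if "n < length (?P k)" for n k
  proof -
    have "?P n ! n = ?P k ! n"
    proof (cases "n \<le> k")
      case True
      then show ?thesis using iterate_mono length_iterate[of n] by (metis nth_append)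
    next
      case False
      then show ?thesis using iterate_mono[of k n] that by (auto simp: nth_append)
    qed
    then show ?thesis by (simp add: w_def)
  qed
  have "stake (length (?P k)) w = ?P k" for k
    by (rule nth_equalityI) (simp_all add: nth)
  then have "w = ?P k @- sdrop (length (?P k)) w" for k
    by (metis stake_sdrop)
  then show ?thesis by blast
qed

lemma fixed_word_ex1: "\<exists>!w. shd w = x \<and> morph_inf f w = w"
proof -
  obtain w where w: "\<And>k. \<exists>r. w = (morph f ^^ k) [x] @- r"
    using prefixes_exist by blast
  have "shd w = x" using w[of 0] by auto
  moreover have "morph_inf f w = w"
  proof (rule stream_eqI)
    fix n
    obtain r where "w = (morph f ^^ n) [x] @- r" using w by blast
    then have "morph_inf f w = (morph f ^^ Suc n) [x] @- morph_inf f r"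
      using morph_inf_shift[of f] nonempty by simp
    then have "stake n (morph_inf f w) = take n ((morph f ^^ Suc n) [x])"
      using length_iterate[of "Suc n"] by (simp add: stake_shift)
    then show "stake n (morph_inf f w) = stake n w"
      using prefixes_imp_stake[OF w, of n "Suc n"] by simp
  qed
  moreover have "w' = w" if "shd w' = x \<and> morph_inf f w' = w'" for w'
  proof (rule stream_eqI)
    fix n
    have "\<And>k. \<exists>r. w' = (morph f ^^ k) [x] @- r"
      using fixed_prefix that by blast
    then show "stake n w' = stake n w"
      using prefixes_imp_stake[OF w, of n n] prefixes_imp_stake[of w' n n] by simp
  qed
  ultimately show ?thesis by blast
qed

lemma fixed_word_props:
  "shd (fixed_word f x) = x" "morph_inf f (fixed_word f x) = fixed_word f x"
  using theI'[OF fixed_word_ex1] unfolding fixed_word_def by blast+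

lemma fixed_word_limit: "words_tendsto (\<lambda>k. (morph f ^^ k) [x]) (fixed_word f x)"
proof -
  have "\<And>k. \<exists>r. fixed_word f x = (morph f ^^ k) [x] @- r"
    using fixed_prefix fixed_word_props by blast
  then show ?thesis
    unfolding words_tendsto_def eventually_sequentially
    using prefixes_imp_stake by blast
qed

end

lemma theta_nonempty: "theta y \<noteq> []"
  by (cases y) auto

lemma tau_nonempty: "tau y \<noteq> []"
  by (cases y) auto

lemma Theta_fixed: "shd Theta = C" "morph_inf theta Theta = Theta"
  and Theta_limit: "words_tendsto (\<lambda>k. (morph theta ^^ k) [C]) Theta"
  unfolding Theta_def
  using fixed_word_props[of theta C "[A, B, A]"] fixed_word_limit[of theta C "[A, B, A]"] theta_nonempty
  by simp_all

lemma Tribonacci_fixed: "shd Tribonacci = A" "morph_inf tau Tribonacci = Tribonacci"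
  and Tribonacci_limit: "words_tendsto (\<lambda>k. (morph tau ^^ k) [A]) Tribonacci"
  unfolding Tribonacci_def
  using fixed_word_props[of tau A "[B]"] fixed_word_limit[of tau A "[B]"] tau_nonempty
  by simp_all

text \<open>The prescribed first letter is implied by the fixed point equation.\<close>

lemma shd_morph_inf: "shd (morph_inf f w) = hd (f (shd w))"
  by (simp add: morph_inf_def)

lemma Theta_unique: "morph_inf theta w = w \<longleftrightarrow> w = Theta"
proof
  assume w: "morph_inf theta w = w"
  have "shd w = hd (theta (shd w))" using shd_morph_inf[of theta w] w by simp
  then have "shd w = C" by (cases "shd w") auto
  with w Theta_fixed show "w = Theta"
    using fixed_word_ex1[of theta C "[A, B, A]"] theta_nonempty by auto
qed (simp add: Theta_fixed)

lemma Tribonacci_unique: "morph_inf tau w = w \<longleftrightarrow> w = Tribonacci"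
proof
  assume w: "morph_inf tau w = w"
  have "shd w = hd (tau (shd w))" using shd_morph_inf[of tau w] w by simp
  then have "shd w = A" by (cases "shd w") auto
  with w Tribonacci_fixed show "w = Tribonacci"
    using fixed_word_ex1[of tau A "[B]"] tau_nonempty by auto
qed (simp add: Tribonacci_fixed)

end

theory Submission
  imports Defs
begin

text \<open>For every letter \<open>y\<close> the words \<open>\<theta>(y)\<close> and \<open>\<tau>\<^sup>3(y)\<close> are conjugate by \<open>ABA\<close>, that is,
  \<open>ABA \<theta>(y) = \<tau>\<^sup>3(y) ABA\<close>.  On infinite words the trailing \<open>ABA\<close> is pushed off to
  infinity, so \<open>ABA \<theta>(w) = \<tau>\<^sup>3(w)\<close>.  For \<open>w = C T\<close>, with \<open>T\<close> the Tribonacci word, the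
  right-hand side is \<open>\<tau>\<^sup>3(C) T = ABAC T\<close>.  Cancelling \<open>ABA\<close> shows that \<open>C T\<close> is a fixed point
  of \<open>\<theta>\<close> beginning with \<open>C\<close>, and \<open>\<Theta>\<close> is the only such word.\<close>

lemma morph_conj:
  assumes "\<And>y. p @ f y = g y @ p"
  shows "p @ morph f u = morph g u @ p"
proof (induction u)
  case (Cons y u)
  have "p @ morph f (y # u) = g y @ p @ morph f u"
    using assms[of y] by (simp add: morph_def flip: append_assoc)
  with Cons show ?case by (simp add: morph_def)
qed (simp add: morph_def)

text \<open>For non-erasing morphisms the conjugating word \<open>p\<close> survives only on the left: every prefix
  of the image of an infinite word is covered by the image of a long enough finite prefix.\<close>

lemma morph_inf_conj:
  assumes f: "\<And>y. f y \<noteq> []" and g: "\<And>y. g y \<noteq> []"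
    and conj: "\<And>y. p @ f y = g y @ p"
  shows "p @- morph_inf f w = morph_inf g w"
proof (rule stream_eqI)
  fix n
  let ?u = "stake n w" and ?v = "sdrop n w"
  have len: "n \<le> length (morph g ?u)"
    using length_morph_ge[of g ?u] g by simp
  have "p @- morph_inf f w = (p @ morph f ?u) @- morph_inf f ?v"
    using morph_inf_shift[of f ?u ?v] f by (simp add: stake_sdrop)
  also have "\<dots> = morph g ?u @- p @- morph_inf f ?v"
    using morph_conj[of p f g ?u] conj by simp
  finally have "stake n (p @- morph_inf f w) = take n (morph g ?u)"
    using len by (simp add: stake_shift)
  moreover have "morph_inf g w = morph g ?u @- morph_inf g ?v"
    using morph_inf_shift[of g ?u ?v] g by (simp add: stake_sdrop)
  then have "stake n (morph_inf g w) = take n (morph g ?u)"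
    using len by (simp add: stake_shift)
  ultimately show "stake n (p @- morph_inf f w) = stake n (morph_inf g w)" by simp
qed

lemma morph_inf_morph:
  assumes f: "\<And>y. f y \<noteq> []" and g: "\<And>y. g y \<noteq> []"
  shows "morph_inf f (morph_inf g w) = morph_inf (\<lambda>y. morph f (g y)) w"
proof (rule stream_eqI)
  fix n
  let ?h = "\<lambda>y. morph f (g y)"
  let ?u = "stake n w" and ?v = "sdrop n w"
  have h: "?h y \<noteq> []" for y
    using length_morph_ge[of f "g y"] f g[of y] by auto
  have len: "n \<le> length (morph ?h ?u)"
    using length_morph_ge[of ?h ?u] h by simp
  have "morph f (morph g u) = morph ?h u" for u
    by (induction u) (simp_all add: morph_def)
  then have "morph_inf f (morph_inf g w) = morph ?h ?u @- morph_inf f (morph_inf g ?v)"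
    using morph_inf_shift[of g ?u ?v] morph_inf_shift[of f "morph g ?u"] f g
    by (simp add: stake_sdrop)
  moreover have "morph_inf ?h w = morph ?h ?u @- morph_inf ?h ?v"
    using morph_inf_shift[of ?h ?u ?v] h by (simp add: stake_sdrop)
  ultimately show "stake n (morph_inf f (morph_inf g w)) = stake n (morph_inf ?h w)"
    using len by (simp add: stake_shift)
qed

lemma theta_conj_tau3: "[A, B, A] @ theta y = morph tau (morph tau (tau y)) @ [A, B, A]"
  by (cases y) (simp_all add: morph_def)

lemma theta_tau3_inf:
  "[A, B, A] @- morph_inf theta w = morph_inf tau (morph_inf tau (morph_inf tau w))"
proof -
  have ne: "morph tau (tau y) \<noteq> []" "morph tau (morph tau (tau y)) \<noteq> []" for y
    by (cases y; simp add: morph_def)+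
  have "morph_inf tau (morph_inf tau (morph_inf tau w)) =
      morph_inf (\<lambda>y. morph tau (morph tau (tau y))) w"
    by (simp add: morph_inf_morph tau_nonempty ne)
  then show ?thesis
    using morph_inf_conj[of theta "\<lambda>y. morph tau (morph tau (tau y))" "[A, B, A]" w]
      theta_nonempty ne theta_conj_tau3 by simp
qed

theorem theorem2:
  shows "Theta = C ## Tribonacci"
proof -
  have step: "morph_inf tau (u @- Tribonacci) = morph tau u @- Tribonacci" for u
    using morph_inf_shift[of tau u Tribonacci] tau_nonempty Tribonacci_fixed by simp
  have "[A, B, A] @- morph_inf theta (C ## Tribonacci) =
      morph tau (morph tau (morph tau [C])) @- Tribonacci"
    using theta_tau3_inf[of "[C] @- Tribonacci"] unfolding step by simp
  also have "\<dots> = [A, B, A] @- C ## Tribonacci"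
    by (simp add: morph_def)
  finally have "morph_inf theta (C ## Tribonacci) = C ## Tribonacci" by simp
  then show ?thesis by (simp only: Theta_unique)
qed

end
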